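(* Let $G$ be a 2-connected undirected graph with $n=|V(G)|$ vertices, and let $H$ be an induced and 2-connected subgraph of $G$. If $H$ is not a locked subgraph of $G$, then the constraint $$x(E(H))\leq n_H-1$$ of $P(G)$ is redundant; that is, it is implied by the following system of constraints on $x\in\mathbb{R}^{E(G)}$: $x(P)\leq 1$ for any essential parallel closure $P$ of $G$; $x(S)\geq |S|-1$ for any essential coparallel closure $S$ of $G$; $x(E(K))\leq n_K-1$ for any locked subgraph $K$ of $G$; $x(E(G))=n-1$.
   Context: Graphs are finite and undirected, and parallel edges are allowed. $P(G)$ is the spanning trees polytope, i.e. the convex hull in $\mathbb{R}^{E(G)}$ of the characteristic vectors of all spanning trees of $G$. For $x\in\mathbb{R}^{E(G)}$ and $F\subseteq E(G)$, $x(F)=\sum_{e\in F}x(e)$. For a subgraph $H$, $n_H=|V(H)|$. A matroid $M$ on $E$ with rank function $r$ is disconnected if there is a proper nonempty subset $X\subset E$ with $r(E)=r(X)+r(E\backslash X)$; otherwise it is 2-connected. $M^*$ is the dual matroid, with rank function $r^*$; $M|X$, $M\backslash X$, $M/X$ denote restriction, deletion and contraction. A parallel closure of $M$ is a maximal subset $P\subseteq E$ with $r(P)=1$ and $r(\{e\})=1$ for every $e\in P$. A coparallel closure of $M$ is a parallel closure of $M^*$. For a 2-connected matroid $M$, a parallel closure $P$ is essential if $M/P$ is 2-connected, and a coparallel closure $S$ is essential if $M\backslash S$ is 2-connected. A subset $L\subset E$ is a locked subset of the 2-connected matroid $M$ if $M|L$ and $M^*|(E\backslash L)$ are both 2-connected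 and $\min\{r(L),r^*(E\backslash L)\}\geq 2$. $M(G)$ is the graphical matroid of $G$: its ground set is $E(G)$ and its bases are the spanning trees of $G$. A graph is 2-connected in the sense that corresponds to 2-connectedness of its graphical matroid. (Essential) parallel and coparallel closures of $G$ are those of $M(G)$. A locked subgraph of $G$ is a subgraph $H$ for which $E(H)$ is a locked subset of $M(G)$. *)

theory Defs
  imports Complex_Main
begin

section \<open>Matroids\<close>

text \<open>A matroid is presented by its ground set and its family of bases. The operations below
  are meant for structures satisfying \<open>is_matroid\<close>.\<close>

record 'e matroid =
  ground :: "'e set"
  bases :: "'e set set"

definition is_matroid :: "'e matroid \<Rightarrow> bool" where
  "is_matroid M \<longleftrightarrow> finite (ground M) \<and> bases M \<noteq> {} \<and> (\<forall>B\<in>bases M. B \<subseteq> ground M) \<and>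
     (\<forall>B\<in>bases M. \<forall>B'\<in>bases M. \<forall>e\<in>B - B'. \<exists>f\<in>B' - B. insert f (B - {e}) \<in> bases M)"

definition rank :: "'e matroid \<Rightarrow> 'e set \<Rightarrow> nat" where
  "rank M X = Max ((\<lambda>B. card (B \<inter> X)) ` bases M)"

definition dual :: "'e matroid \<Rightarrow> 'e matroid" where
  "dual M = \<lparr>ground = ground M, bases = (\<lambda>B. ground M - B) ` bases M\<rparr>"

text \<open>The sets \<open>B \<inter> X\<close> of cardinality \<open>rank M X\<close> are the maximal independent subsets of \<open>X\<close>.\<close>

definition restriction :: "'e matroid \<Rightarrow> 'e set \<Rightarrow> 'e matroid" where
  "restriction M X = \<lparr>ground = X, bases = {B \<inter> X | B. B \<in> bases M \<and> card (B \<inter> X) = rank M X}\<rparr>"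

definition deletion :: "'e matroid \<Rightarrow> 'e set \<Rightarrow> 'e matroid" where
  "deletion M X = restriction M (ground M - X)"

definition contraction :: "'e matroid \<Rightarrow> 'e set \<Rightarrow> 'e matroid" where
  "contraction M X = dual (deletion (dual M) X)"

definition disconnected_matroid :: "'e matroid \<Rightarrow> bool" where
  "disconnected_matroid M \<longleftrightarrow>
     (\<exists>X. X \<noteq> {} \<and> X \<subset> ground M \<and> rank M (ground M) = rank M X + rank M (ground M - X))"

text \<open>In particular, matroids with at most one element are 2-connected.\<close>

definition two_connected_matroid :: "'e matroid \<Rightarrow> bool" where
  "two_connected_matroid M \<longleftrightarrow> \<not> disconnected_matroid M"

definition parallel_set :: "'e matroid \<Rightarrow> 'e set \<Rightarrow> bool" where
  "parallel_set M P \<longleftrightarrow> P \<subseteq> ground M \<and> rank M P = 1 \<and> (\<forall>e\<in>P. rank M {e} = 1)"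

definition parallel_closure :: "'e matroid \<Rightarrow> 'e set \<Rightarrow> bool" where
  "parallel_closure M P \<longleftrightarrow> parallel_set M P \<and> (\<forall>Q. parallel_set M Q \<and> P \<subseteq> Q \<longrightarrow> Q = P)"

definition coparallel_closure :: "'e matroid \<Rightarrow> 'e set \<Rightarrow> bool" where
  "coparallel_closure M S \<longleftrightarrow> parallel_closure (dual M) S"

definition essential_parallel_closure :: "'e matroid \<Rightarrow> 'e set \<Rightarrow> bool" where
  "essential_parallel_closure M P \<longleftrightarrow>
     parallel_closure M P \<and> two_connected_matroid (contraction M P)"

definition essential_coparallel_closure :: "'e matroid \<Rightarrow> 'e set \<Rightarrow> bool" where
  "essential_coparallel_closure M S \<longleftrightarrow>
     coparallel_closure M S \<and> two_connected_matroid (deletion M S)"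

definition locked_subset :: "'e matroid \<Rightarrow> 'e set \<Rightarrow> bool" where
  "locked_subset M L \<longleftrightarrow> L \<subset> ground M \<and>
     two_connected_matroid (restriction M L) \<and>
     two_connected_matroid (restriction (dual M) (ground M - L)) \<and>
     min (rank M L) (rank (dual M) (ground M - L)) \<ge> 2"


section \<open>Undirected multigraphs\<close>

text \<open>Every edge carries its set of end vertices, so parallel edges are distinct edges with the
  same ends. Loops (edges with a single end) are not excluded.\<close>

record ('v, 'e) mgraph =
  verts :: "'v set"
  edges :: "'e set"
  ends :: "'e \<Rightarrow> 'v set"

definition graph :: "('v, 'e) mgraph \<Rightarrow> bool" where
  "graph G \<longleftrightarrow> finite (verts G) \<and> finite (edges G) \<and>
     (\<forall>e\<in>edges G. ends G e \<subseteq> verts G \<and> card (ends G e) \<in> {1, 2})"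

definition subgraph :: "('v, 'e) mgraph \<Rightarrow> ('v, 'e) mgraph \<Rightarrow> bool" where
  "subgraph H G \<longleftrightarrow> graph H \<and> verts H \<subseteq> verts G \<and> edges H \<subseteq> edges G \<and>
     (\<forall>e\<in>edges H. ends H e = ends G e)"

definition induced_subgraph :: "('v, 'e) mgraph \<Rightarrow> ('v, 'e) mgraph \<Rightarrow> bool" where
  "induced_subgraph H G \<longleftrightarrow> subgraph H G \<and> edges H = {e \<in> edges G. ends G e \<subseteq> verts H}"

definition adjacency :: "('v, 'e) mgraph \<Rightarrow> ('v \<times> 'v) set" where
  "adjacency G = {(u, v). \<exists>e\<in>edges G. ends G e = {u, v}}"

definition connected_graph :: "('v, 'e) mgraph \<Rightarrow> bool" where
  "connected_graph G \<longleftrightarrow>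
     verts G \<noteq> {} \<and> (\<forall>u\<in>verts G. \<forall>v\<in>verts G. (u, v) \<in> (adjacency G)\<^sup>*)"

text \<open>A cycle of length 1 is a loop, a cycle of length 2 a pair of parallel edges.\<close>

definition is_cycle :: "('v, 'e) mgraph \<Rightarrow> 'v list \<Rightarrow> 'e list \<Rightarrow> bool" where
  "is_cycle G vs es \<longleftrightarrow> vs \<noteq> [] \<and> length es = length vs \<and> distinct vs \<and> distinct es \<and>
     set es \<subseteq> edges G \<and>
     (\<forall>i<length vs. ends G (es ! i) = {vs ! i, vs ! (Suc i mod length vs)})"

definition is_tree :: "('v, 'e) mgraph \<Rightarrow> bool" where
  "is_tree G \<longleftrightarrow> connected_graph G \<and> (\<nexists>vs es. is_cycle G vs es)"

text \<open>A spanning tree is identified with its edge set.\<close>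

definition spanning_tree :: "('v, 'e) mgraph \<Rightarrow> 'e set \<Rightarrow> bool" where
  "spanning_tree G T \<longleftrightarrow> T \<subseteq> edges G \<and> is_tree (G\<lparr>edges := T\<rparr>)"

definition graphical_matroid :: "('v, 'e) mgraph \<Rightarrow> 'e matroid" where
  "graphical_matroid G = \<lparr>ground = edges G, bases = {T. spanning_tree G T}\<rparr>"

text \<open>Connectedness has to be required separately: a disconnected graph has no spanning trees,
  and then \<open>graphical_matroid G\<close> is not a matroid.\<close>

definition two_connected_graph :: "('v, 'e) mgraph \<Rightarrow> bool" where
  "two_connected_graph G \<longleftrightarrow> connected_graph G \<and> two_connected_matroid (graphical_matroid G)"

definition locked_subgraph :: "('v, 'e) mgraph \<Rightarrow> ('v, 'e) mgraph \<Rightarrow> bool" where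
  "locked_subgraph H G \<longleftrightarrow> subgraph H G \<and> locked_subset (graphical_matroid G) (edges H)"

end

theory Submission
  imports Defs
begin

text \<open>Let \<open>r\<close> be the rank function of \<open>M(G)\<close> and suppose that \<open>x(A) > r(A)\<close> for some \<open>A\<close>. A smallest
  such \<open>A\<close> has \<open>M|A\<close> 2-connected. Among all violated \<open>A\<close> with \<open>M|A\<close> 2-connected take a largest one:
  then \<open>M/A\<close> is 2-connected too, since for a separation \<open>B\<^sub>1, B\<^sub>2\<close> of \<open>M/A\<close> both \<open>M|(A \<union> B\<^sub>i)\<close> are
  2-connected and \<open>x(E) = r(E)\<close> forces one of \<open>A \<union> B\<^sub>1\<close>, \<open>A \<union> B\<^sub>2\<close> to be violated. If \<open>r(A) = 1\<close> this
  \<open>A\<close> is an essential parallel closure, if \<open>r\<^sup>*(E - A) = 1\<close> its complement is an essential coparallel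
  closure, and otherwise \<open>A\<close> is locked; so a given constraint is violated. The only exception is
  the matroid of two parallel edges, which together are the only nonempty edge set of an induced
  subgraph.\<close>

section \<open>Matroids\<close>

lemma card_exchange:
  assumes "finite B" "e \<in> B" "f \<notin> B"
  shows "card (insert f (B - {e})) = card B"
proof -
  have "card (insert f (B - {e})) = Suc (card (B - {e}))"
    using assms by (intro card_insert_disjoint) auto
  also have "\<dots> = card B" by (rule card_Suc_Diff1[OF assms(1,2)])
  finally show ?thesis .
qed

locale matroid_bases =
  fixes M :: "'e matroid"
  assumes matroid: "is_matroid M"
begin

abbreviation "E \<equiv> ground M"
abbreviation "r \<equiv> rank M"

lemma finite_ground: "finite E"
  using matroid by (simp add: is_matroid_def)

lemma basis_subset: "B \<in> bases M \<Longrightarrow> B \<subseteq> E"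
  using matroid by (simp add: is_matroid_def)

lemma finite_basis: "B \<in> bases M \<Longrightarrow> finite B"
  using basis_subset finite_ground finite_subset by blast

lemma finite_bases: "finite (bases M)"
  by (rule finite_subset[of _ "Pow E"]) (auto simp: finite_ground dest: basis_subset)

lemma bases_nonempty: "bases M \<noteq> {}"
  using matroid by (simp add: is_matroid_def)

lemma exchange:
  assumes "B \<in> bases M" "B' \<in> bases M" "e \<in> B - B'"
  obtains f where "f \<in> B' - B" "insert f (B - {e}) \<in> bases M"
  using matroid assms unfolding is_matroid_def by blast

text \<open>Exchanging elements of \<open>B - B'\<close> for elements of \<open>B'\<close> keeps the
  size of \<open>B\<close> and shrinks \<open>B - B'\<close> until \<open>B\<close> lies in
  \<open>B'\<close>.\<close>

lemma card_basis_le: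
  assumes "B \<in> bases M" "B' \<in> bases M"
  shows "card B \<le> card B'"
  using assms(1)
proof (induction "card (B - B')" arbitrary: B rule: less_induct)
  case less
  show ?case
  proof (cases "B \<subseteq> B'")
    case True
    then show ?thesis using assms(2) by (simp add: card_mono finite_basis)
  next
    case False
    then obtain e where e: "e \<in> B - B'" by blast
    obtain f where f: "f \<in> B' - B" "insert f (B - {e}) \<in> bases M"
      by (rule exchange[OF less.prems assms(2) e])
    have "insert f (B - {e}) - B' \<subset> B - B'" using e f(1) by auto
    then have "card (insert f (B - {e}) - B') < card (B - B')"
      by (intro psubset_card_mono finite_Diff finite_basis[OF less.prems])
    then have "card (insert f (B - {e})) \<le> card B'" using less.hyps f(2) by blast
    moreover have "card (insert f (B - {e})) = card B"
      using e f(1) by (intro card_exchange finite_basis[OF less.prems]) auto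
    ultimately show ?thesis by simp
  qed
qed

lemma card_basis_eq: "B \<in> bases M \<Longrightarrow> B' \<in> bases M \<Longrightarrow> card B = card B'"
  using card_basis_le le_antisym by blast

section \<open>The rank function: augmentation and submodularity\<close>

lemma card_le_rank: "B \<in> bases M \<Longrightarrow> card (B \<inter> X) \<le> r X"
  unfolding rank_def by (rule Max_ge) (auto simp: finite_bases)

lemma rank_attained:
  obtains B where "B \<in> bases M" "card (B \<inter> X) = r X"
proof -
  have "r X \<in> (\<lambda>B. card (B \<inter> X)) ` bases M"
    unfolding rank_def by (rule Max_in) (auto simp: finite_bases bases_nonempty)
  then show ?thesis using that by auto
qed

lemma rank_leI: "(\<And>B. B \<in> bases M \<Longrightarrow> card (B \<inter> X) \<le> k) \<Longrightarrow> r X \<le> k"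
  by (rule rank_attained[of X]) metis

lemma rank_mono:
  assumes "X \<subseteq> Y"
  shows "r X \<le> r Y"
proof (rule rank_leI)
  fix B assume B: "B \<in> bases M"
  have "card (B \<inter> X) \<le> card (B \<inter> Y)" using assms finite_basis[OF B] by (intro card_mono) auto
  then show "card (B \<inter> X) \<le> r Y" using card_le_rank[OF B] le_trans by blast
qed

lemma rank_le_card: "finite X \<Longrightarrow> r X \<le> card X"
  by (rule rank_leI) (simp add: card_mono)

lemma card_basis:
  assumes "B \<in> bases M"
  shows "card B = r E"
proof -
  obtain B' where B': "B' \<in> bases M" "card (B' \<inter> E) = r E" by (rule rank_attained)
  then show ?thesis using card_basis_eq[OF assms B'(1)] basis_subset[OF B'(1)] by (simp add: inf.absorb1)
qed

text \<open>Since bases are equicardinal, \<open>B\<close> is larger than \<open>B'\<close> outside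
  \<open>Y\<close> and has some \<open>e\<close> there that \<open>B'\<close> lacks. Exchanging
  \<open>e\<close> for an element of \<open>B'\<close> either gains an element in \<open>Y\<close>
  or leaves \<open>B \<inter> Y\<close> alone and brings \<open>B\<close> closer to
  \<open>B'\<close>.\<close>

lemma augment:
  assumes "B \<in> bases M" "B' \<in> bases M" "card (B \<inter> Y) < card (B' \<inter> Y)"
  shows "\<exists>B1\<in>bases M. B \<inter> Y \<subset> B1 \<inter> Y"
  using assms(1,3)
proof (induction "card (B - B')" arbitrary: B rule: less_induct)
  case less
  have fin: "finite B" "finite B'" using less.prems assms(2) finite_basis by auto
  have "card B = card (B \<inter> Y) + card (B - Y)" "card B' = card (B' \<inter> Y) + card (B' - Y)"
    using fin card_Int_Diff by blast+
  then have "card (B' - Y) < card (B - Y)"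
    using card_basis_eq[OF less.prems(1) assms(2)] less.prems(2) by linarith
  then have "\<not> B - Y \<subseteq> B' - Y" using fin by (meson card_mono finite_Diff leD)
  then obtain e where e: "e \<in> B - B'" "e \<notin> Y" by blast
  obtain f where f: "f \<in> B' - B" "insert f (B - {e}) \<in> bases M"
    by (rule exchange[OF less.prems(1) assms(2) e(1)])
  show ?case
  proof (cases "f \<in> Y")
    case True
    then have "B \<inter> Y \<subset> insert f (B - {e}) \<inter> Y" using e f(1) by blast
    then show ?thesis using f(2) by blast
  next
    case False
    have "insert f (B - {e}) - B' \<subset> B - B'" using e f(1) by auto
    then have less_card: "card (insert f (B - {e}) - B') < card (B - B')"
      by (intro psubset_card_mono finite_Diff fin)
    have "insert f (B - {e}) \<inter> Y = B \<inter> Y" using False e(2) by blast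
    then show ?thesis using less.hyps[OF less_card f(2)] less.prems(2) by simp
  qed
qed

text \<open>By augmentation, a trace on \<open>X\<close> that no other basis enlarges has full rank.
  This is how ranks are computed from a single basis later on.\<close>

lemma card_eq_rank_if_maximal:
  assumes "B \<in> bases M"
    and "\<And>B1. B1 \<in> bases M \<Longrightarrow> B \<inter> X \<subseteq> B1 \<Longrightarrow> B1 \<inter> X \<subseteq> B"
  shows "card (B \<inter> X) = r X"
proof (rule ccontr)
  assume "card (B \<inter> X) \<noteq> r X"
  then have "card (B \<inter> X) < r X" using card_le_rank[OF assms(1)] le_neq_implies_less by blast
  moreover obtain B' where "B' \<in> bases M" "card (B' \<inter> X) = r X" by (rule rank_attained)
  ultimately obtain B1 where "B1 \<in> bases M" "B \<inter> X \<subset> B1 \<inter> X"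
    using augment[OF assms(1)] by metis
  then show False using assms(2) by blast
qed

lemma extend_to_rank:
  assumes "B \<in> bases M"
  obtains B1 where "B1 \<in> bases M" "B \<inter> X \<subseteq> B1" "card (B1 \<inter> X) = r X"
proof -
  obtain B1 where B1: "B1 \<in> bases M \<and> B \<inter> X \<subseteq> B1"
    and max: "\<And>B2. B2 \<in> bases M \<and> B \<inter> X \<subseteq> B2 \<Longrightarrow> card (B2 \<inter> X) \<le> card (B1 \<inter> X)"
    using ex_has_greatest_nat[of "\<lambda>B1. B1 \<in> bases M \<and> B \<inter> X \<subseteq> B1" B "\<lambda>B1. card (B1 \<inter> X)"
        "Suc (r X)"] assms card_le_rank less_Suc_eq_le by blast
  have "card (B1 \<inter> X) = r X"
  proof (rule card_eq_rank_if_maximal)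
    fix B2 assume B2: "B2 \<in> bases M" "B1 \<inter> X \<subseteq> B2"
    then have "card (B2 \<inter> X) \<le> card (B1 \<inter> X)" using B1 max by blast
    then have "B1 \<inter> X = B2 \<inter> X"
      using B2 finite_basis by (intro card_seteq) auto
    then show "B2 \<inter> X \<subseteq> B1" by blast
  qed (use B1 in blast)
  then show ?thesis using that B1(1) by blast
qed

text \<open>A trace of full rank on \<open>X\<close> is extended within \<open>Y\<close>; the part
  in \<open>X\<close> cannot shrink. A single basis serving both sets reduces submodularity and
  ranks in restrictions to counting.\<close>

lemma rank_attained_chain:
  assumes "X \<subseteq> Y"
  obtains B where "B \<in> bases M" "card (B \<inter> X) = r X" "card (B \<inter> Y) = r Y"
proof -
  obtain B where B: "B \<in> bases M" "card (B \<inter> X) = r X" by (rule rank_attained)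
  obtain B1 where B1: "B1 \<in> bases M" "B \<inter> Y \<subseteq> B1" "card (B1 \<inter> Y) = r Y"
    by (rule extend_to_rank[OF B(1)])
  have "B \<inter> X \<subseteq> B1 \<inter> X" using B1(2) assms by blast
  then have "card (B \<inter> X) \<le> card (B1 \<inter> X)" using B1(1) by (simp add: card_mono finite_basis)
  then have "card (B1 \<inter> X) = r X" using B(2) card_le_rank[OF B1(1), of X] by simp
  then show ?thesis using that B1 by blast
qed

lemma rank_submodular: "r (X \<union> Y) + r (X \<inter> Y) \<le> r X + r Y"
proof -
  obtain B where B: "B \<in> bases M" "card (B \<inter> (X \<inter> Y)) = r (X \<inter> Y)"
    "card (B \<inter> (X \<union> Y)) = r (X \<union> Y)"
    by (rule rank_attained_chain[of "X \<inter> Y" "X \<union> Y"]) auto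
  have "card (B \<inter> X \<union> B \<inter> Y) + card (B \<inter> X \<inter> (B \<inter> Y)) = card (B \<inter> X) + card (B \<inter> Y)"
    using finite_basis[OF B(1)] by (intro card_Un_Int[symmetric]) auto
  moreover have "B \<inter> X \<union> B \<inter> Y = B \<inter> (X \<union> Y)" "B \<inter> X \<inter> (B \<inter> Y) = B \<inter> (X \<inter> Y)" by auto
  ultimately show ?thesis using B card_le_rank[OF B(1), of X] card_le_rank[OF B(1), of Y] by simp
qed

lemma rank_empty [simp]: "r {} = 0"
  using rank_le_card[of "{}"] by simp

lemma rank_subadditive: "X \<subseteq> Y \<Longrightarrow> r Y \<le> r X + r (Y - X)"
  using rank_submodular[of X "Y - X"] by (simp add: Un_absorb1)

lemma two_connected_rank_less:
  assumes "two_connected_matroid M" "X \<noteq> {}" "X \<subset> E"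
  shows "r E < r X + r (E - X)"
proof -
  have "r E \<noteq> r X + r (E - X)"
    using assms by (auto simp: two_connected_matroid_def disconnected_matroid_def)
  then show ?thesis using rank_subadditive[of X E] assms(3) by (auto simp: psubset_eq)
qed

section \<open>Duality\<close>

lemma is_matroid_dual: "is_matroid (dual M)"
  unfolding is_matroid_def
proof (intro conjI ballI)
  show "finite (ground (dual M))" "bases (dual M) \<noteq> {}"
    by (auto simp: dual_def finite_ground bases_nonempty)
next
  fix C assume "C \<in> bases (dual M)"
  then show "C \<subseteq> ground (dual M)" by (auto simp: dual_def)
next
  fix C C' e assume C: "C \<in> bases (dual M)" "C' \<in> bases (dual M)" and e: "e \<in> C - C'"
  from C obtain B B' where B: "B \<in> bases M" "B' \<in> bases M" "C = E - B" "C' = E - B'"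
    by (auto simp: dual_def)
  have e': "e \<in> B' - B" "e \<in> E" using e B by auto
  \<comment> \<open>Extending \<open>B' \<inter> insert e B\<close> inside
    \<open>insert e B\<close>, which has full rank, yields a basis contained in
    \<open>insert e B\<close>. It omits exactly one element \<open>f\<close> of \<open>B\<close>,
    and \<open>f\<close> is not in \<open>B'\<close> because \<open>B3\<close> keeps all of
    \<open>B' \<inter> insert e B\<close>.\<close>
  obtain B3 where B3: "B3 \<in> bases M" "B' \<inter> insert e B \<subseteq> B3"
    "card (B3 \<inter> insert e B) = r (insert e B)"
    by (rule extend_to_rank[OF B(2)])
  have "r (insert e B) = card B3"
  proof (rule antisym)
    show "r (insert e B) \<le> card B3"
      using card_basis[OF B3(1)] rank_mono[of "insert e B" E] basis_subset[OF B(1)] e'(2) by simp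
    show "card B3 \<le> r (insert e B)"
      using card_basis[OF B3(1)] card_basis[OF B(1)] card_le_rank[OF B(1), of "insert e B"]
      by (simp add: Int_absorb2 subset_insertI)
  qed
  then have sub: "B3 \<subseteq> insert e B"
    using B3(3) finite_basis[OF B3(1)] by (metis card_subset_eq inf.absorb_iff1 inf_le1)
  have "e \<in> B3" using B3(2) e' by blast
  have card: "card B3 = card B" using card_basis_eq B3(1) B(1) by blast
  have "\<not> B \<subseteq> B3"
  proof
    assume "B \<subseteq> B3"
    then have "B = B3" using card finite_basis[OF B3(1)] card_subset_eq by metis
    then show False using \<open>e \<in> B3\<close> e' by blast
  qed
  then obtain f where f: "f \<in> B" "f \<notin> B3" by blast
  have "B3 \<subseteq> insert e (B - {f})" using sub f by blast
  moreover have "card (insert e (B - {f})) = card B3"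
    using card f e' card_exchange[OF finite_basis[OF B(1)]] by simp
  ultimately have B3_eq: "B3 = insert e (B - {f})"
    using finite_basis[OF B(1)] by (simp add: card_subset_eq)
  have "f \<notin> B'" using f B3(2) by blast
  moreover have "insert f (C - {e}) = E - B3"
    using B3_eq B f e' basis_subset by blast
  ultimately show "\<exists>f\<in>C' - C. insert f (C - {e}) \<in> bases (dual M)"
    using B f B3(1) basis_subset by (intro bexI[of _ f]) (auto simp: dual_def)
qed

lemma dual_dual [simp]: "dual (dual M) = M"
proof -
  have "(\<lambda>B. E - B) ` (\<lambda>B. E - B) ` bases M = bases M"
    using basis_subset by (auto simp: image_image double_diff image_iff Bex_def)
  then show ?thesis by (simp add: dual_def)
qed

text \<open>The usual formula for the corank, written without subtraction on naturals. For a single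
  basis it is a count, and a basis that is large on \<open>E - X\<close> has a complement that is
  large on \<open>X\<close>.\<close>

lemma rank_dual:
  assumes "X \<subseteq> E"
  shows "rank (dual M) X + r E = card X + r (E - X)"
proof -
  interpret D: matroid_bases "dual M" by unfold_locales (rule is_matroid_dual)
  have fin: "finite X" using assms finite_ground finite_subset by blast
  have eq: "card ((E - B) \<inter> X) + r E = card X + card (B \<inter> (E - X))" if B: "B \<in> bases M" for B
  proof -
    have "card X = card (X \<inter> B) + card (X - B)" using fin card_Int_Diff by blast
    moreover have "card B = card (B \<inter> X) + card (B - X)" using finite_basis[OF B] card_Int_Diff by blast
    moreover have "(E - B) \<inter> X = X - B" "B \<inter> (E - X) = B - X" "X \<inter> B = B \<inter> X"
      using assms basis_subset[OF B] by auto
    ultimately show ?thesis using card_basis[OF B] by simp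
  qed
  obtain B where B: "B \<in> bases M" "card (B \<inter> (E - X)) = r (E - X)" by (rule rank_attained)
  obtain C where C: "C \<in> bases (dual M)" "card (C \<inter> X) = rank (dual M) X" by (rule D.rank_attained)
  obtain B' where B': "B' \<in> bases M" "C = E - B'" using C(1) by (auto simp: dual_def)
  have "card ((E - B) \<inter> X) \<le> rank (dual M) X"
    using B(1) by (intro D.card_le_rank) (auto simp: dual_def)
  then show ?thesis
    using eq[OF B(1)] B(2) eq[OF B'(1)] C(2) B'(2) card_le_rank[OF B'(1), of "E - X"] by simp
qed

section \<open>Restrictions\<close>

lemma rank_restriction:
  assumes "Y \<subseteq> X"
  shows "rank (restriction M X) Y = r Y"
proof -
  let ?S = "(\<lambda>C. card (C \<inter> Y)) ` bases (restriction M X)"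
  have eq: "B \<inter> X \<inter> Y = B \<inter> Y" for B using assms by blast
  obtain B where B: "B \<in> bases M" "card (B \<inter> Y) = r Y" "card (B \<inter> X) = r X"
    using rank_attained_chain[OF assms] .
  have "Max ?S = r Y"
  proof (rule Max_eqI)
    have "?S \<subseteq> (\<lambda>B. card (B \<inter> Y)) ` bases M" by (auto simp: restriction_def eq)
    then show "finite ?S" using finite_bases finite_surj by blast
    show "k \<le> r Y" if "k \<in> ?S" for k
      using that card_le_rank by (auto simp: restriction_def eq)
    have "B \<inter> X \<in> bases (restriction M X)" using B by (auto simp: restriction_def)
    then show "r Y \<in> ?S" by (rule rev_image_eqI) (simp add: eq B)
  qed
  then show ?thesis by (simp add: rank_def)
qed

lemma is_matroid_restriction:
  assumes "X \<subseteq> E"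
  shows "is_matroid (restriction M X)"
  unfolding is_matroid_def
proof (intro conjI ballI)
  show "finite (ground (restriction M X))"
    using assms finite_ground finite_subset by (auto simp: restriction_def)
  show "bases (restriction M X) \<noteq> {}"
    using rank_attained[of X] by (auto simp: restriction_def)
next
  fix C assume "C \<in> bases (restriction M X)"
  then show "C \<subseteq> ground (restriction M X)" by (auto simp: restriction_def)
next
  fix C C' e
  assume C: "C \<in> bases (restriction M X)" "C' \<in> bases (restriction M X)" and e: "e \<in> C - C'"
  from C obtain B B' where B: "B \<in> bases M" "C = B \<inter> X" "card C = r X"
    and B': "B' \<in> bases M" "C' = B' \<inter> X" "card C' = r X"
    by (auto simp: restriction_def)
  \<comment> \<open>\<open>Y\<close> has full rank in \<open>X\<close> because of \<open>C'\<close>,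
    yet \<open>B\<close> meets it only in \<open>C - {e}\<close>. Hence extending
    \<open>C - {e}\<close> within \<open>Y\<close> must add an element of
    \<open>C' - C\<close>.\<close>
  define Y where "Y = (C - {e}) \<union> C'"
  have fin: "finite C" using B finite_basis by simp
  have Y: "Y \<subseteq> X" using B(2) B'(2) by (auto simp: Y_def)
  have BY: "B \<inter> Y = C - {e}" using B(2) B'(2) e by (auto simp: Y_def)
  have rY: "r Y = r X"
  proof (rule antisym)
    show "r Y \<le> r X" by (rule rank_mono[OF Y])
    have "card C' \<le> card (B' \<inter> Y)"
      using B' finite_basis by (intro card_mono) (auto simp: Y_def)
    then show "r X \<le> r Y" using B'(3) card_le_rank[OF B'(1), of Y] by simp
  qed
  obtain B3 where B3: "B3 \<in> bases M" "B \<inter> Y \<subseteq> B3" "card (B3 \<inter> Y) = r Y"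
    by (rule extend_to_rank[OF B(1)])
  have fin3: "finite (B3 \<inter> X)" using B3(1) finite_basis by blast
  have eq: "B3 \<inter> Y = B3 \<inter> X"
    using Y fin3 card_le_rank[OF B3(1), of X] B3(3) rY by (intro card_seteq) auto
  have "card (C - {e}) < card (B3 \<inter> X)"
    using e fin B(3) B3(3) rY eq by (metis DiffD1 card_Diff1_less)
  moreover have CB3: "C - {e} \<subseteq> B3 \<inter> X" using B3(2) BY eq by blast
  ultimately obtain f where f: "f \<in> B3 \<inter> X" "f \<notin> C - {e}" by (metis less_irrefl subsetI subset_antisym)
  have f': "f \<in> C' - C" using f eq e by (auto simp: Y_def)
  have "card (insert f (C - {e})) = card (B3 \<inter> X)"
    using e fin B(3) B3(3) rY eq f' card_exchange by (metis DiffD1 DiffD2)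
  then have "insert f (C - {e}) = B3 \<inter> X"
    using f CB3 fin3 by (intro card_subset_eq) auto
  moreover have "B3 \<inter> X \<in> bases (restriction M X)"
    using B3 eq rY by (auto simp: restriction_def)
  ultimately show "\<exists>f\<in>C' - C. insert f (C - {e}) \<in> bases (restriction M X)" using f' by metis
qed

section \<open>Connectedness of restrictions, duals and contractions\<close>

lemma two_connected_restriction_iff:
  "two_connected_matroid (restriction M X) \<longleftrightarrow>
     (\<forall>Z. Z \<noteq> {} \<and> Z \<subset> X \<longrightarrow> r X \<noteq> r Z + r (X - Z))"
proof -
  have "ground (restriction M X) = X" by (simp add: restriction_def)
  then show ?thesis
    unfolding two_connected_matroid_def disconnected_matroid_def
    by (auto simp: rank_restriction psubset_imp_subset)
qed

text \<open>The excess \<open>r X + r (E - X) - r E\<close> is the same for a matroid and its dual,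
  since the cardinalities in \<open>rank_dual\<close> cancel.\<close>

lemma two_connected_dual:
  assumes "two_connected_matroid M"
  shows "two_connected_matroid (dual M)"
proof -
  have "rank (dual M) E \<noteq> rank (dual M) X + rank (dual M) (E - X)"
    if X: "X \<noteq> {}" "X \<subset> E" for X
  proof -
    have "E - (E - X) = X" using X by blast
    moreover have "card E = card X + card (E - X)"
      using X finite_ground by (metis card_Int_Diff inf.absorb_iff2 psubset_imp_subset)
    ultimately show ?thesis
      using rank_dual[of E] rank_dual[of X] rank_dual[of "E - X"] X
        two_connected_rank_less[OF assms X] by (simp add: psubset_imp_subset)
  qed
  then show ?thesis
    by (auto simp: two_connected_matroid_def disconnected_matroid_def dual_def)
qed

text \<open>The rank of \<open>Z\<close> in the contraction of \<open>A\<close> is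
  \<open>r (A \<union> Z) - r A\<close>, and \<open>E - Z\<close> is the union of \<open>A\<close>
  with the rest of \<open>E - A\<close>. So the right-hand side forbids separators of that
  contraction, in terms of \<open>r\<close> alone.\<close>

lemma two_connected_corestriction_iff:
  assumes "A \<subseteq> E"
  shows "two_connected_matroid (restriction (dual M) (E - A)) \<longleftrightarrow>
     (\<forall>Z. Z \<noteq> {} \<and> Z \<subset> E - A \<longrightarrow> r E + r A \<noteq> r (E - Z) + r (A \<union> Z))"
proof -
  interpret D: matroid_bases "dual M" by unfold_locales (rule is_matroid_dual)
  have "rank (dual M) (E - A) = rank (dual M) Z + rank (dual M) (E - A - Z) \<longleftrightarrow>
      r E + r A = r (E - Z) + r (A \<union> Z)" if Z: "Z \<noteq> {}" "Z \<subset> E - A" for Z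
  proof -
    have "E - (E - A) = A" "E - (E - A - Z) = A \<union> Z" "Z \<subseteq> E" using Z assms by auto
    moreover have "card (E - A) = card Z + card (E - A - Z)"
      using Z finite_ground by (metis card_Int_Diff finite_Diff inf.absorb_iff2 psubset_imp_subset)
    ultimately show ?thesis
      using rank_dual[of "E - A"] rank_dual[of Z] rank_dual[of "E - A - Z"] by fastforce
  qed
  then show ?thesis unfolding D.two_connected_restriction_iff by blast
qed

text \<open>By definition the contraction of \<open>A\<close> is the dual of the restriction of
  \<open>dual M\<close> to \<open>E - A\<close>, and connectedness is self-dual.\<close>

lemma two_connected_contraction:
  assumes "two_connected_matroid (restriction (dual M) (E - A))"
  shows "two_connected_matroid (contraction M A)"
proof -
  interpret D: matroid_bases "dual M" by unfold_locales (rule is_matroid_dual)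
  interpret R: matroid_bases "restriction (dual M) (E - A)"
    by unfold_locales (rule D.is_matroid_restriction, simp add: dual_def)
  have "contraction M A = dual (restriction (dual M) (E - A))"
    by (simp add: contraction_def deletion_def) (simp add: dual_def)
  then show ?thesis using R.two_connected_dual[OF assms] by simp
qed

text \<open>A loop in \<open>A\<close> would separate the restriction to \<open>A\<close>; an
  element outside that is parallel to \<open>A\<close> would become a loop, hence a separator, once
  \<open>A\<close> is contracted.\<close>

lemma parallel_closure_if_two_connected:
  assumes A: "A \<subseteq> E" "r A = 1"
    and conn: "two_connected_matroid (restriction M A)"
    and coconn: "two_connected_matroid (restriction (dual M) (E - A))"
    and nontriv: "\<not> (card (E - A) = 1 \<and> r E = 1)"
  shows "parallel_closure M A"
  unfolding parallel_closure_def
proof (intro conjI allI impI)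
  have "r {e} = 1" if e: "e \<in> A" for e
  proof (rule ccontr)
    assume "r {e} \<noteq> 1"
    then have r0: "r {e} = 0" using rank_le_card[of "{e}"] by simp
    then have "{e} \<subset> A" using A(2) e by auto
    then have "r A \<noteq> r {e} + r (A - {e})" using conn by (auto simp: two_connected_restriction_iff)
    then show False using r0 rank_subadditive[of "{e}" A] rank_mono[of "A - {e}" A] e by auto
  qed
  then show "parallel_set M A" using A by (simp add: parallel_set_def)
next
  fix Q assume Q: "parallel_set M Q \<and> A \<subseteq> Q"
  show "Q = A"
  proof (rule ccontr)
    assume "Q \<noteq> A"
    then obtain e where e: "e \<in> Q" "e \<notin> A" using Q by blast
    have QE: "Q \<subseteq> E" "r Q = 1" using Q by (auto simp: parallel_set_def)
    have rAe: "r (A \<union> {e}) = 1"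
    proof (rule antisym)
      show "r (A \<union> {e}) \<le> 1" using rank_mono[of "A \<union> {e}" Q] Q QE(2) e(1) by simp
      show "1 \<le> r (A \<union> {e})" using rank_mono[of A "A \<union> {e}"] A(2) by (simp add: subset_insertI)
    qed
    show False
    \<comment> \<open>If \<open>e\<close> is the only element outside \<open>A\<close>, it is no
      proper subset of \<open>E - A\<close> and \<open>coconn\<close> says nothing. Then all of
      \<open>E\<close> has rank 1, which \<open>nontriv\<close> excludes.\<close>
    proof (cases "E - A = {e}")
      case True
      then have "E \<subseteq> insert e A" by blast
      then have "Q = E" using Q QE e by blast
      then show False using nontriv True QE by simp
    next
      case False
      then have "{e} \<subset> E - A" using e QE by blast
      then have "r E + r A \<noteq> r (E - {e}) + r (A \<union> {e})"
        using coconn two_connected_corestriction_iff[OF A(1)] by blast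
      moreover have "r (E - {e}) \<le> r E" by (rule rank_mono) auto
      moreover have "r E + r A \<le> r (E - {e}) + r (A \<union> {e})"
      proof -
        have "(E - {e}) \<union> (A \<union> {e}) = E" "(E - {e}) \<inter> (A \<union> {e}) = A" using A e QE by auto
        then show ?thesis using rank_submodular[of "E - {e}" "A \<union> {e}"] by simp
      qed
      ultimately show False using rAe A by simp
    qed
  qed
qed

text \<open>Going from \<open>A\<close> to \<open>A \<union> B\<close> for a separator \<open>B\<close> of \<open>M/A\<close> preserves connectedness: a
  separator of \<open>A \<union> B\<close> avoiding \<open>A\<close> would be a separator of \<open>M\<close>.\<close>

lemma two_connected_restriction_Un:
  assumes "two_connected_matroid M"
    and A: "A \<subseteq> E" "A \<noteq> {}" "two_connected_matroid (restriction M A)"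
    and B: "B \<subseteq> E - A" and sep: "r E + r A = r (E - B) + r (A \<union> B)"
  shows "two_connected_matroid (restriction M (A \<union> B))"
  unfolding two_connected_restriction_iff
proof (intro allI impI notI)
  fix Z assume Z: "Z \<noteq> {} \<and> Z \<subset> A \<union> B" and eq: "r (A \<union> B) = r Z + r (A \<union> B - Z)"
  \<comment> \<open>Submodularity for \<open>E - B\<close> and \<open>A \<union> B - Y\<close>,
    combined with \<open>sep\<close>, turns such a \<open>Y\<close> into a separator of
    \<open>M\<close>.\<close>
  have no_sep: False if Y: "Y \<noteq> {}" "Y \<subseteq> B" "r (A \<union> B) = r Y + r (A \<union> B - Y)" for Y
  proof -
    have "(E - B) \<union> (A \<union> B - Y) = E - Y" "(E - B) \<inter> (A \<union> B - Y) = A" "Y \<subset> E"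
      using A B Y by auto
    then show False
      using rank_submodular[of "E - B" "A \<union> B - Y"] two_connected_rank_less[OF assms(1), of Y]
        sep Y by simp
  qed
  \<comment> \<open>If \<open>Z\<close> cut \<open>A\<close>, submodularity for \<open>A\<close>,
    \<open>Z\<close> and for \<open>A \<union> Z\<close>, \<open>A \<union> B - Z\<close> would pass
    the separation of \<open>A \<union> B\<close> on to \<open>A\<close>.\<close>
  have "A \<subseteq> Z \<or> A \<inter> Z = {}"
  proof (rule ccontr)
    assume *: "\<not> (A \<subseteq> Z \<or> A \<inter> Z = {})"
    then have "A \<inter> Z \<noteq> {}" "A \<inter> Z \<subset> A" by auto
    then have "r A \<noteq> r (A \<inter> Z) + r (A - A \<inter> Z)"
      using A(3) unfolding two_connected_restriction_iff by simp
    then have lt: "r A < r (A \<inter> Z) + r (A - Z)"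
      using rank_subadditive[of "A \<inter> Z" A] by (simp add: Diff_Int)
    have "A \<union> Z \<union> (A \<union> B - Z) = A \<union> B" "(A \<union> Z) \<inter> (A \<union> B - Z) = A - Z"
      using Z by auto
    then have "r (A \<union> B) + r (A - Z) \<le> r (A \<union> Z) + r (A \<union> B - Z)"
      using rank_submodular[of "A \<union> Z" "A \<union> B - Z"] by simp
    then show False using rank_submodular[of A Z] lt eq by simp
  qed
  then consider "A \<subseteq> Z" | "A \<inter> Z = {}" by blast
  then show False
  proof cases
    case 1
    then have "A \<union> B - Z \<noteq> {}" "A \<union> B - Z \<subseteq> B" "A \<union> B - (A \<union> B - Z) = Z" using Z by auto
    then show False using no_sep[of "A \<union> B - Z"] eq by simp
  next
    case 2
    then have "Z \<subseteq> B" using Z by blast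
    then show False using no_sep[of Z] Z eq by blast
  qed
qed

end

section \<open>The constraints of the basis polytope\<close>

text \<open>The second alternative is the uniform matroid of rank 1 on two elements \<open>a\<close>, \<open>b\<close>, where
  \<open>x a \<le> 1\<close> does not follow from the constraints.\<close>

theorem (in matroid_bases) basis_polytope_constraints:
  fixes x :: "'e \<Rightarrow> real"
  assumes conn: "two_connected_matroid M"
    and par: "\<And>P. essential_parallel_closure M P \<Longrightarrow> sum x P \<le> 1"
    and copar: "\<And>S. essential_coparallel_closure M S \<Longrightarrow> sum x S \<ge> real (card S) - 1"
    and locked: "\<And>L. locked_subset M L \<Longrightarrow> sum x L \<le> real (r L)"
    and total: "sum x E = real (r E)"
  shows "(\<forall>A\<subseteq>E. sum x A \<le> real (r A)) \<or> (card E = 2 \<and> r E = 1)"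
proof (rule disjCI, intro allI impI, rule ccontr)
  fix A0 assume "A0 \<subseteq> E" "\<not> sum x A0 \<le> real (r A0)" and no2: "\<not> (card E = 2 \<and> r E = 1)"
  define neg where "neg A \<longleftrightarrow> A \<subseteq> E \<and> real (r A) < sum x A" for A
  have sum_split: "sum x Y = sum x Z + sum x (Y - Z)" if "Z \<subseteq> Y" "Y \<subseteq> E" for Y Z
    using that finite_ground by (metis add.commute finite_subset sum.subset_diff)
  have "neg A0" using \<open>A0 \<subseteq> E\<close> \<open>\<not> sum x A0 \<le> real (r A0)\<close> by (simp add: neg_def)
  then obtain A1 where A1: "neg A1" and A1_min: "\<And>A. neg A \<Longrightarrow> card A1 \<le> card A"
    using exists_least_iff[of "\<lambda>k. \<exists>A. neg A \<and> card A = k"] by (metis not_less)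
  \<comment> \<open>Both parts of a separation are smaller than \<open>A1\<close> and satisfy their
    constraints, whose sum would be the constraint of \<open>A1\<close>.\<close>
  have "two_connected_matroid (restriction M A1)"
    unfolding two_connected_restriction_iff
  proof (intro allI impI notI)
    fix Z assume Z: "Z \<noteq> {} \<and> Z \<subset> A1" and eq: "r A1 = r Z + r (A1 - Z)"
    have "A1 \<subseteq> E" using A1 by (simp add: neg_def)
    then have fin: "finite A1" using finite_ground finite_subset by blast
    have "card Z < card A1" "card (A1 - Z) < card A1"
      using Z fin by (auto intro!: psubset_card_mono)
    then have "\<not> neg Z" "\<not> neg (A1 - Z)" using A1_min leD by blast+
    then show False
      using sum_split[of Z A1] Z A1 eq by (auto simp: neg_def)
  qed
  define good where "good A \<longleftrightarrow> neg A \<and> two_connected_matroid (restriction M A)" for A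
  have "good A1" using A1 \<open>two_connected_matroid (restriction M A1)\<close> by (simp add: good_def)
  moreover have bounded: "card A \<le> card E" if "good A" for A
    using that finite_ground by (simp add: good_def neg_def card_mono)
  ultimately obtain A where A: "good A" and A_max: "\<And>A'. good A' \<Longrightarrow> card A' \<le> card A"
    using ex_has_greatest_nat[of good A1 card "Suc (card E)"] less_Suc_eq_le by blast
  have AE: "A \<subseteq> E" and negA: "real (r A) < sum x A"
    and Aconn: "two_connected_matroid (restriction M A)"
    using A by (auto simp: good_def neg_def)
  have A_ne: "A \<noteq> {}" and A_prop: "A \<subset> E" using negA total AE by auto
  have coconn: "two_connected_matroid (restriction (dual M) (E - A))"
    unfolding two_connected_corestriction_iff[OF AE]
  proof (intro allI impI notI)
    fix Z assume Z: "Z \<noteq> {} \<and> Z \<subset> E - A" and eq: "r E + r A = r (E - Z) + r (A \<union> Z)"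
    define W where "W = E - A - Z"
    have W: "W \<noteq> {}" "W \<subset> E - A" "E - W = A \<union> Z" "A \<union> W = E - Z"
      using Z AE by (auto simp: W_def)
    \<comment> \<open>For a separator \<open>B\<close> the set \<open>A \<union> B\<close> is again
      connected and larger than \<open>A\<close>, so maximality of \<open>A\<close> forbids a
      violation.\<close>
    have not_neg: "\<not> neg (A \<union> B)" if "B \<noteq> {}" "B \<subseteq> E - A"
      "r E + r A = r (E - B) + r (A \<union> B)" for B
    proof
      assume "neg (A \<union> B)"
      then have "good (A \<union> B)"
        using two_connected_restriction_Un[OF conn AE A_ne Aconn] that by (simp add: good_def)
      then have "card (A \<union> B) \<le> card A" by (rule A_max)
      moreover have "card A < card (A \<union> B)"
        using that AE finite_ground by (intro psubset_card_mono) (auto intro: finite_subset)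
      ultimately show False by simp
    qed
    \<comment> \<open>The contradiction is that
      \<open>x(A \<union> Z) + x(A \<union> W) = x(E) + x(A)\<close> exceeds
      \<open>r E + r A\<close>, which by \<open>eq\<close> is the sum of the ranks of the two
      sets.\<close>
    have "\<not> neg (A \<union> Z)" using not_neg Z eq by blast
    moreover have "\<not> neg (A \<union> W)" using not_neg[of W] W eq by auto
    moreover have "A \<union> Z \<subseteq> E" "A \<union> W \<subseteq> E" using Z W AE by auto
    moreover have "sum x E = sum x Z + sum x (A \<union> W)"
      using sum_split[of Z E] Z W by auto
    moreover have "sum x (A \<union> Z) = sum x A + sum x Z"
    proof -
      have "A \<union> Z - A = Z" using Z by blast
      then show ?thesis using sum_split[of A "A \<union> Z"] \<open>A \<union> Z \<subseteq> E\<close> by auto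
    qed
    ultimately show False using eq W total negA by (auto simp: neg_def)
  qed
  interpret D: matroid_bases "dual M" by unfold_locales (rule is_matroid_dual)
  have EEA: "E - (E - A) = A" using AE by blast
  have ground_dual: "ground (dual M) = E" by (simp add: dual_def)
  have cardE: "card E = card A + card (E - A)"
    using AE finite_ground by (metis card_Int_Diff inf.absorb_iff2)
  have rank_D: "rank (dual M) (E - A) + r E = card (E - A) + r A"
    using rank_dual[of "E - A"] EEA by simp
  \<comment> \<open>Connectedness of \<open>M\<close> makes both the rank of \<open>A\<close> and
    the corank of \<open>E - A\<close> positive, so being less than 2 means being equal to
    1.\<close>
  have "r E < r A + r (E - A)" by (rule two_connected_rank_less[OF conn A_ne A_prop])
  then have pos: "r A \<noteq> 0" "rank (dual M) (E - A) \<noteq> 0"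
    using rank_mono[of "E - A" E] rank_D rank_le_card[of "E - A"] finite_ground by auto
  have rank_one: "card (E - A) = 1 \<and> r E = 1" if "r A = 1"
  proof (rule ccontr)
    assume "\<not> (card (E - A) = 1 \<and> r E = 1)"
    then have "essential_parallel_closure M A"
      using parallel_closure_if_two_connected[OF AE that Aconn coconn]
        two_connected_contraction[OF coconn] by (simp add: essential_parallel_closure_def)
    then show False using par negA that by fastforce
  qed
  have corank_one: "card A = 1" if "rank (dual M) (E - A) = 1"
  proof (rule ccontr)
    assume "card A \<noteq> 1"
    \<comment> \<open>The criterion for parallel closures is applied to the dual, where the two
      connectedness assumptions change roles and the excluded case has
      \<open>card A = 1\<close>.\<close>
    then have "parallel_closure (dual M) (E - A)"
      using D.parallel_closure_if_two_connected[of "E - A"] that Aconn coconn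
      by (simp add: ground_dual EEA)
    then have "essential_coparallel_closure M (E - A)"
      using Aconn by (simp add: essential_coparallel_closure_def coparallel_closure_def
          deletion_def EEA)
    then have "sum x (E - A) \<ge> real (card (E - A)) - 1" by (rule copar)
    \<comment> \<open>Corank 1 means \<open>card (E - A) - 1 = r E - r A\<close>, so with
      \<open>total\<close> the constraint reads \<open>x(A) \<le> r A\<close>.\<close>
    then show False using sum_split[OF AE] total negA rank_D that by simp
  qed
  show False
  proof (cases "r A = 1 \<or> rank (dual M) (E - A) = 1")
    case True
    \<comment> \<open>Each of the two exceptional cases implies the other, which leaves one element
      in \<open>A\<close> and one outside: the matroid excluded by \<open>no2\<close>.\<close>
    have "r A = 1"
      using True corank_one rank_le_card[of A] pos(1) AE finite_ground finite_subset by fastforce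
    then have "card (E - A) = 1" "r E = 1" using rank_one by auto
    then have "card A = 1" using corank_one rank_D \<open>r A = 1\<close> by simp
    then show False using no2 cardE \<open>card (E - A) = 1\<close> \<open>r E = 1\<close> by simp
  next
    case False
    then have "locked_subset M A"
      using A_prop Aconn coconn pos by (auto simp: locked_subset_def)
    then show False using locked negA by fastforce
  qed
qed

section \<open>Forests\<close>

text \<open>Taking the end map and the edge set as separate arguments makes deleting and adding
  edges plain set operations.\<close>

definition reach :: "('e \<Rightarrow> 'v set) \<Rightarrow> 'e set \<Rightarrow> ('v \<times> 'v) set" where
  "reach d F = {(u, v). \<exists>e\<in>F. d e = {u, v}}\<^sup>*"

text \<open>Acyclicity without cycles: every edge is a bridge. Loops are excluded because
  reachability is reflexive.\<close>

definition forest :: "('e \<Rightarrow> 'v set) \<Rightarrow> 'e set \<Rightarrow> bool" where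
  "forest d F \<longleftrightarrow> (\<forall>e\<in>F. \<forall>u v. d e = {u, v} \<longrightarrow> (u, v) \<notin> reach d (F - {e}))"

lemma reach_refl [simp]: "(a, a) \<in> reach d F"
  by (simp add: reach_def)

lemma reach_edge: "e \<in> F \<Longrightarrow> d e = {u, v} \<Longrightarrow> (u, v) \<in> reach d F"
  unfolding reach_def by (rule r_into_rtrancl) auto

lemma reach_trans: "(a, b) \<in> reach d F \<Longrightarrow> (b, c) \<in> reach d F \<Longrightarrow> (a, c) \<in> reach d F"
  unfolding reach_def by (rule rtrancl_trans)

lemma reach_sym: "(a, b) \<in> reach d F \<Longrightarrow> (b, a) \<in> reach d F"
proof -
  have "sym {(u, v). \<exists>e\<in>F. d e = {u, v}}" by (auto simp: sym_def insert_commute)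
  then show "(a, b) \<in> reach d F \<Longrightarrow> (b, a) \<in> reach d F"
    unfolding reach_def by (meson symD sym_rtrancl)
qed

lemma reach_mono: "F \<subseteq> F' \<Longrightarrow> (a, b) \<in> reach d F \<Longrightarrow> (a, b) \<in> reach d F'"
  unfolding reach_def by (rule rtrancl_mono[THEN subsetD]) auto

lemma reach_induct [consumes 1, case_names refl step]:
  assumes "(a, b) \<in> reach d F" "P a"
    "\<And>b c e. (a, b) \<in> reach d F \<Longrightarrow> e \<in> F \<Longrightarrow> d e = {b, c} \<Longrightarrow> P b \<Longrightarrow> P c"
  shows "P b"
  using assms(1) unfolding reach_def
proof (induction rule: rtrancl_induct)
  case base
  show ?case by (rule assms(2))
next
  case (step b c)
  then show ?case using assms(3) by (auto simp: reach_def)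
qed

text \<open>A walk between two components of \<open>F\<close> must use an edge that leaves a
  component. This supplies the new edge both for extending forests and for exchanging tree
  edges.\<close>

lemma crossing_edge:
  assumes "(a, b) \<in> reach d F'" "(a, b) \<notin> reach d F"
  obtains e u v where "e \<in> F'" "d e = {u, v}" "(u, v) \<notin> reach d F"
proof -
  have "(a, b) \<in> reach d F" if "\<And>e u v. e \<in> F' \<Longrightarrow> d e = {u, v} \<Longrightarrow> (u, v) \<in> reach d F"
    using assms(1) by (induction rule: reach_induct) (auto intro: reach_trans that)
  then show ?thesis using assms(2) that by blast
qed

lemma reach_insert:
  assumes "d e = {u, v}"
  shows "(a, b) \<in> reach d (insert e F) \<longleftrightarrow> (a, b) \<in> reach d F \<or>
    (a, u) \<in> reach d F \<and> (v, b) \<in> reach d F \<or> (a, v) \<in> reach d F \<and> (u, b) \<in> reach d F"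
    (is "?L \<longleftrightarrow> ?R b")
proof
  assume ?L
  then show "?R b"
  proof (induction rule: reach_induct)
    case (step b c g)
    show ?case
    proof (cases "g = e")
      case True
      then have "(b = u \<and> c = v) \<or> (b = v \<and> c = u)" using step assms by (auto simp: doubleton_eq_iff)
      then show ?thesis using step(4) by (meson reach_refl)
    next
      case False
      then have "(b, c) \<in> reach d F" using step by (auto intro: reach_edge)
      then show ?thesis using step(4) by (meson reach_trans)
    qed
  qed simp
next
  have uv: "(u, v) \<in> reach d (insert e F)" "(v, u) \<in> reach d (insert e F)"
    using assms reach_edge[of e "insert e F"] reach_sym by fastforce+
  have mono: "(p, q) \<in> reach d F \<Longrightarrow> (p, q) \<in> reach d (insert e F)" for p q
    by (rule reach_mono[of F]) auto
  assume "?R b"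
  then show ?L by (meson mono uv reach_trans)
qed

lemma forest_subset: "forest d F \<Longrightarrow> F' \<subseteq> F \<Longrightarrow> forest d F'"
  unfolding forest_def by (meson Diff_mono reach_mono subset_iff subset_refl)

text \<open>If an old edge \<open>g\<close> lost its bridge property, a detour through
  \<open>e\<close> would join its ends; walking that detour backwards and using \<open>g\<close>
  would join \<open>u\<close> and \<open>v\<close> inside \<open>F\<close>.\<close>

lemma forest_insert:
  assumes "forest d F" "d e = {u, v}" "(u, v) \<notin> reach d F"
  shows "forest d (insert e F)"
  unfolding forest_def
proof (intro ballI allI impI notI)
  fix g a b assume g: "g \<in> insert e F" "d g = {a, b}" and ab: "(a, b) \<in> reach d (insert e F - {g})"
  show False
  proof (cases "g = e")
    case True
    then have "insert e F - {g} \<subseteq> F" by blast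
    then have "(a, b) \<in> reach d F" using ab by (rule reach_mono)
    then show False
      using assms(2,3) g(2) True reach_sym[of a b d F] by (auto simp: doubleton_eq_iff)
  next
    case False
    then have gF: "g \<in> F" and eq: "insert e F - {g} = insert e (F - {g})" using g by auto
    have mono: "(p, q) \<in> reach d (F - {g}) \<Longrightarrow> (p, q) \<in> reach d F" for p q
      by (rule reach_mono[of "F - {g}"]) auto
    have "(a, b) \<notin> reach d (F - {g})" using assms(1) gF g(2) by (auto simp: forest_def)
    then have "(a, u) \<in> reach d (F - {g}) \<and> (v, b) \<in> reach d (F - {g}) \<or>
        (a, v) \<in> reach d (F - {g}) \<and> (u, b) \<in> reach d (F - {g})"
      using ab reach_insert[of d e u v a b "F - {g}", OF assms(2)] unfolding eq by blast
    moreover have "(a, b) \<in> reach d F" using gF g(2) by (rule reach_edge)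
    ultimately have "(u, v) \<in> reach d F" by (meson mono reach_sym reach_trans)
    then show False using assms(3) by blast
  qed
qed

section \<open>Components of a forest and the number of its edges\<close>

lemma reach_class_eq_iff: "reach d F `` {a} = reach d F `` {b} \<longleftrightarrow> (a, b) \<in> reach d F"
proof
  assume "reach d F `` {a} = reach d F `` {b}"
  then show "(a, b) \<in> reach d F" using reach_refl by fastforce
next
  assume "(a, b) \<in> reach d F"
  then show "reach d F `` {a} = reach d F `` {b}" by (auto intro: reach_trans reach_sym)
qed

text \<open>Without edges every vertex is its own component, and each further forest edge merges two
  components into one.\<close>

lemma forest_card_components:
  assumes "finite F" "forest d F" "finite W" "\<And>e. e \<in> F \<Longrightarrow> \<exists>u\<in>W. \<exists>v\<in>W. d e = {u, v}"
  shows "card ((\<lambda>a. reach d F `` {a}) ` W) + card F = card W"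
  using assms(1,2,4)
proof (induction F rule: finite_induct)
  case empty
  have "reach d {} `` {a} = {a}" for a by (auto simp: reach_def)
  then show ?case by (simp add: card_image)
next
  case (insert e F)
  obtain u v where uv: "u \<in> W" "v \<in> W" "d e = {u, v}" using insert.prems by blast
  have "insert e F - {e} = F" using insert.hyps by blast
  then have nuv: "(u, v) \<notin> reach d F" using insert.prems(1) uv by (fastforce simp: forest_def)
  have "forest d F" using insert.prems(1) forest_subset by blast
  then have IH: "card ((\<lambda>a. reach d F `` {a}) ` W) + card F = card W"
    using insert.IH insert.prems(2) by blast
  define C where "C a = reach d F `` {a}" for a
  have C_iff: "C a = C b \<longleftrightarrow> (a, b) \<in> reach d F" for a b
    unfolding C_def by (rule reach_class_eq_iff)
  \<comment> \<open>The classes of \<open>u\<close> and \<open>v\<close> are merged and all others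
    stay as they are.\<close>
  have C': "reach d (insert e F) `` {a} = (if C a \<in> {C u, C v} then C u \<union> C v else C a)" for a
  proof -
    have "b \<in> C a \<longleftrightarrow> C a = C b" for a b using C_iff by (simp add: C_def)
    moreover have "b \<in> reach d (insert e F) `` {a} \<longleftrightarrow>
        C a = C b \<or> C a = C u \<and> C v = C b \<or> C a = C v \<and> C u = C b" for b
      using reach_insert[of d e u v a b F, OF uv(3)] C_iff by simp
    ultimately show ?thesis by (intro set_eqI) auto
  qed
  have "(\<lambda>a. reach d (insert e F) `` {a}) ` W = insert (C u \<union> C v) (C ` W - {C u, C v})"
    unfolding C' using uv by (auto split: if_splits)
  moreover have "C u \<union> C v \<notin> C ` W - {C u, C v}"
  proof
    assume "C u \<union> C v \<in> C ` W - {C u, C v}"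
    then obtain a where a: "C a = C u \<union> C v" "C a \<noteq> C u" by auto
    have "u \<in> C a" unfolding a(1) by (simp add: C_def)
    then show False using a(2) C_iff[of a u] by (simp add: C_def)
  qed
  moreover have "card (C ` W - {C u, C v}) + 2 = card (C ` W)"
  proof -
    have "C u \<noteq> C v" using C_iff nuv by blast
    then have "card {C u, C v} = 2" by simp
    moreover have "card (C ` W - {C u, C v}) = card (C ` W) - card {C u, C v}"
      using uv by (intro card_Diff_subset) auto
    moreover have "card {C u, C v} \<le> card (C ` W)"
      using uv assms(3) by (intro card_mono) auto
    ultimately show ?thesis by simp
  qed
  ultimately have "card ((\<lambda>a. reach d (insert e F) `` {a}) ` W) + 1 = card (C ` W)"
    using assms(3) by simp
  moreover have "C ` W = (\<lambda>a. reach d F `` {a}) ` W" by (simp add: C_def)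
  ultimately show ?case using IH insert.hyps by simp
qed

lemma forest_card_less:
  assumes "finite F" "forest d F" "finite W" "W \<noteq> {}"
    "\<And>e. e \<in> F \<Longrightarrow> \<exists>u\<in>W. \<exists>v\<in>W. d e = {u, v}"
  shows "card F + 1 \<le> card W"
proof -
  have "card ((\<lambda>a. reach d F `` {a}) ` W) \<noteq> 0" using assms(3,4) by simp
  then show ?thesis using forest_card_components[OF assms(1,2,3,5)] by linarith
qed

text \<open>The edge count is one less than the vertex count exactly when there is a single
  component. This allows spanning trees to be recognised by counting.\<close>

lemma forest_card_eq_iff:
  assumes "finite F" "forest d F" "finite W" "W \<noteq> {}"
    "\<And>e. e \<in> F \<Longrightarrow> \<exists>u\<in>W. \<exists>v\<in>W. d e = {u, v}"
  shows "card F + 1 = card W \<longleftrightarrow> (\<forall>a\<in>W. \<forall>b\<in>W. (a, b) \<in> reach d F)"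
proof -
  let ?C = "\<lambda>a. reach d F `` {a}"
  have "card F + 1 = card W \<longleftrightarrow> card (?C ` W) = 1"
    using forest_card_components[OF assms(1,2,3,5)] by linarith
  also have "\<dots> \<longleftrightarrow> (\<forall>a\<in>W. \<forall>b\<in>W. ?C a = ?C b)"
  proof
    assume "card (?C ` W) = 1"
    then obtain c where "?C ` W = {c}" by (rule card_1_singletonE)
    then show "\<forall>a\<in>W. \<forall>b\<in>W. ?C a = ?C b" by (metis image_eqI singletonD)
  next
    assume *: "\<forall>a\<in>W. \<forall>b\<in>W. ?C a = ?C b"
    obtain w where "w \<in> W" using assms(4) by blast
    then have "?C ` W = {?C w}" using * by blast
    then show "card (?C ` W) = 1" by simp
  qed
  finally show ?thesis unfolding reach_class_eq_iff .
qed

text \<open>In a walk of least length no vertex repeats, since the stretch between two visits could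
  be cut out.\<close>

lemma reach_simple_path:
  assumes "(u, v) \<in> reach d F"
  obtains f n where "f 0 = u" "f n = v" "inj_on f {..n}"
    "\<And>i. i < n \<Longrightarrow> \<exists>e\<in>F. d e = {f i, f (Suc i)}"
proof -
  define A where "A = {(u, v). \<exists>e\<in>F. d e = {u, v}}"
  define n where "n = (LEAST n. (u, v) \<in> A ^^ n)"
  have "\<exists>n. (u, v) \<in> A ^^ n" using assms by (simp add: reach_def A_def rtrancl_power)
  then have "(u, v) \<in> A ^^ n" unfolding n_def by (rule LeastI_ex)
  then obtain f where f: "f 0 = u" "f n = v" "\<And>i. i < n \<Longrightarrow> (f i, f (Suc i)) \<in> A"
    unfolding relpow_fun_conv by blast
  have "f i \<noteq> f j" if "i < j" "j \<le> n" for i j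
  proof
    assume eq: "f i = f j"
    have "(u, f i) \<in> A ^^ i" unfolding relpow_fun_conv using f that by (intro exI[of _ f]) auto
    moreover have "(f j, v) \<in> A ^^ (n - j)"
      unfolding relpow_fun_conv using f that by (intro exI[of _ "\<lambda>k. f (j + k)"]) auto
    ultimately have "(u, v) \<in> A ^^ (i + (n - j))" unfolding relpow_add using eq by auto
    then have "n \<le> i + (n - j)" unfolding n_def by (rule Least_le)
    then show False using that by simp
  qed
  then have "inj_on f {..n}" by (intro inj_onI) (metis atMost_iff linorder_neqE_nat)
  then show ?thesis using that f by (auto simp: A_def)
qed

section \<open>The matroid of a connected graph\<close>

lemma edge_ends:
  assumes "graph G" "e \<in> edges G"
  obtains u v where "u \<in> verts G" "v \<in> verts G" "ends G e = {u, v}"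
proof -
  have "ends G e \<subseteq> verts G" "card (ends G e) = 1 \<or> card (ends G e) = 2"
    using assms by (auto simp: graph_def)
  then show ?thesis using that by (auto simp: card_1_singleton_iff card_2_iff)
qed

text \<open>The first edge of a cycle is bypassed by the others; conversely, a simple path that
  avoids a non-bridge and joins its ends closes up to a cycle.\<close>

lemma acyclic_iff_forest:
  assumes "graph G" "F \<subseteq> edges G"
  shows "(\<exists>vs es. is_cycle (G\<lparr>edges := F\<rparr>) vs es) \<longleftrightarrow> \<not> forest (ends G) F"
proof
  assume "\<exists>vs es. is_cycle (G\<lparr>edges := F\<rparr>) vs es"
  then obtain vs es where cyc: "is_cycle (G\<lparr>edges := F\<rparr>) vs es" by blast
  define n where "n = length vs"
  have n: "n > 0" "length es = n" "distinct es" "set es \<subseteq> F"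
    and e: "\<And>i. i < n \<Longrightarrow> ends G (es ! i) = {vs ! i, vs ! (Suc i mod n)}"
    using cyc by (auto simp: is_cycle_def n_def)
  \<comment> \<open>The walk follows the edges with indices 1 to \<open>i\<close> and so avoids
    \<open>es ! 0\<close>. At \<open>i = n - 1\<close> the index wraps around to vertex 0; for a
    loop, \<open>n = 1\<close>, the walk is trivial.\<close>
  have "(vs ! (Suc 0 mod n), vs ! (Suc i mod n)) \<in> reach (ends G) (F - {es ! 0})" if "i < n" for i
    using that
  proof (induction i)
    case (Suc i)
    have "es ! Suc i \<noteq> es ! 0" using n Suc.prems by (simp add: nth_eq_iff_index_eq)
    moreover have "es ! Suc i \<in> F" using n Suc.prems by (meson nth_mem subsetD)
    ultimately have "(vs ! Suc i, vs ! (Suc (Suc i) mod n)) \<in> reach (ends G) (F - {es ! 0})"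
      using e[OF Suc.prems] by (intro reach_edge[of "es ! Suc i"]) auto
    moreover have "Suc i mod n = Suc i" using Suc.prems by simp
    ultimately show ?case using Suc reach_trans by fastforce
  qed simp
  from this[of "n - 1"] have "(vs ! (Suc 0 mod n), vs ! 0) \<in> reach (ends G) (F - {es ! 0})"
    using n(1) by simp
  then have "(vs ! 0, vs ! (Suc 0 mod n)) \<in> reach (ends G) (F - {es ! 0})" by (rule reach_sym)
  moreover have "es ! 0 \<in> F" using n by (meson nth_mem subsetD)
  ultimately show "\<not> forest (ends G) F" using e[OF n(1)] unfolding forest_def by blast
next
  assume "\<not> forest (ends G) F"
  then obtain e u v where e: "e \<in> F" "ends G e = {u, v}" "(u, v) \<in> reach (ends G) (F - {e})"
    unfolding forest_def by blast
  obtain f n where f: "f 0 = u" "f n = v" "inj_on f {..n}"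
    and "\<And>i. i < n \<Longrightarrow> \<exists>g\<in>F - {e}. ends G g = {f i, f (Suc i)}"
    using reach_simple_path[OF e(3)] by metis
  then obtain g where g: "\<And>i. i < n \<Longrightarrow> g i \<in> F - {e}"
    "\<And>i. i < n \<Longrightarrow> ends G (g i) = {f i, f (Suc i)}"
    by metis
  \<comment> \<open>On a simple path the pair of ends determines the position of the edge: the
    crossed case would need both \<open>i = Suc j\<close> and \<open>j = Suc i\<close>.\<close>
  have "inj_on g {..<n}"
  proof (rule inj_onI)
    fix i j assume ij: "i \<in> {..<n}" "j \<in> {..<n}" and "g i = g j"
    then have "{f i, f (Suc i)} = {f j, f (Suc j)}" using g(2) by (metis lessThan_iff)
    then have "(f i = f j) \<or> (f i = f (Suc j) \<and> f (Suc i) = f j)" by (auto simp: doubleton_eq_iff)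
    then show "i = j"
      using ij inj_onD[OF f(3), of i j] inj_onD[OF f(3), of i "Suc j"]
        inj_onD[OF f(3), of "Suc i" j] by auto
  qed
  then have "distinct (map g [0..<n] @ [e])"
    using g(1) by (auto simp: distinct_map atLeast0LessThan)
  moreover have "distinct (map f [0..<Suc n])"
  proof -
    have "inj_on f (set [0..<Suc n])" by (rule inj_on_subset[OF f(3)]) auto
    then show ?thesis by (simp add: distinct_map del: upt_Suc)
  qed
  moreover have "ends G ((map g [0..<n] @ [e]) ! i) =
      {map f [0..<Suc n] ! i, map f [0..<Suc n] ! (Suc i mod Suc n)}" if "i < Suc n" for i
  proof (cases "i = n")
    case True
    then show ?thesis using f e by (simp add: nth_append insert_commute del: upt_Suc)
  next
    case False
    then have "i < n" using that by simp
    then show ?thesis using g(2) by (simp add: nth_append del: upt_Suc)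
  qed
  moreover have "set (map g [0..<n] @ [e]) \<subseteq> F" using g(1) e(1) by auto
  ultimately have "is_cycle (G\<lparr>edges := F\<rparr>) (map f [0..<Suc n]) (map g [0..<n] @ [e])"
    unfolding is_cycle_def by (simp del: upt_Suc)
  then show "\<exists>vs es. is_cycle (G\<lparr>edges := F\<rparr>) vs es" by blast
qed

locale connected_mgraph =
  fixes G :: "('v, 'e) mgraph"
  assumes graph: "graph G" and connected: "connected_graph G"
begin

abbreviation "d \<equiv> ends G"

lemma finite_edges: "finite (edges G)" and finite_verts: "finite (verts G)"
  and verts_nonempty: "verts G \<noteq> {}"
  using graph connected by (auto simp: graph_def connected_graph_def)

lemma reach_edges: "u \<in> verts G \<Longrightarrow> v \<in> verts G \<Longrightarrow> (u, v) \<in> reach d (edges G)"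
  using connected by (simp add: connected_graph_def adjacency_def reach_def)

lemma edge_in_verts: "F \<subseteq> edges G \<Longrightarrow> e \<in> F \<Longrightarrow> \<exists>u\<in>verts G. \<exists>v\<in>verts G. d e = {u, v}"
  using edge_ends[OF graph] by (metis subsetD)

section \<open>Spanning trees as the bases of a matroid\<close>

lemma spanning_tree_iff:
  "spanning_tree G T \<longleftrightarrow>
     T \<subseteq> edges G \<and> forest d T \<and> (\<forall>u\<in>verts G. \<forall>v\<in>verts G. (u, v) \<in> reach d T)"
proof (cases "T \<subseteq> edges G")
  case True
  then show ?thesis
    using acyclic_iff_forest[OF graph True] verts_nonempty
    by (auto simp: spanning_tree_def is_tree_def connected_graph_def adjacency_def reach_def)
qed (simp add: spanning_tree_def)

lemma spanning_tree_iff_card: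
  "spanning_tree G T \<longleftrightarrow> T \<subseteq> edges G \<and> forest d T \<and> card T + 1 = card (verts G)"
proof (cases "T \<subseteq> edges G \<and> forest d T")
  case True
  then have "finite T" using finite_edges finite_subset by blast
  then show ?thesis
    unfolding spanning_tree_iff
    using forest_card_eq_iff[of T d "verts G"] True finite_verts verts_nonempty
      edge_in_verts[of T] by metis
qed (auto simp: spanning_tree_iff)

text \<open>A largest forest containing \<open>F\<close> spans, as otherwise an edge of
  \<open>G\<close> between two of its components could be added.\<close>

lemma forest_extends:
  assumes "F \<subseteq> edges G" "forest d F"
  obtains T where "spanning_tree G T" "F \<subseteq> T"
proof -
  let ?P = "\<lambda>T. F \<subseteq> T \<and> T \<subseteq> edges G \<and> forest d T"
  obtain T where T: "?P T" and max: "\<And>T'. ?P T' \<Longrightarrow> card T' \<le> card T"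
    using ex_has_greatest_nat[of ?P F card "Suc (card (edges G))"] assms
      card_mono[OF finite_edges] less_Suc_eq_le by blast
  have "(u, v) \<in> reach d T" if uv: "u \<in> verts G" "v \<in> verts G" for u v
  proof (rule ccontr)
    assume nuv: "(u, v) \<notin> reach d T"
    obtain e a b where e: "e \<in> edges G" "d e = {a, b}" "(a, b) \<notin> reach d T"
      by (rule crossing_edge[OF reach_edges[OF uv] nuv])
    have "?P (insert e T)" using T e forest_insert[where d = d, OF _ e(2,3)] by blast
    then have "card (insert e T) \<le> card T" by (rule max)
    moreover have "e \<notin> T" using e(2,3) reach_edge by metis
    moreover have "finite T" using T finite_edges finite_subset by blast
    ultimately show False by simp
  qed
  then show ?thesis using that T spanning_tree_iff by blast
qed

lemma ground_graphical [simp]: "ground (graphical_matroid G) = edges G"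
  by (simp add: graphical_matroid_def)

lemma bases_graphical [simp]: "T \<in> bases (graphical_matroid G) \<longleftrightarrow> spanning_tree G T"
  by (simp add: graphical_matroid_def)

text \<open>Removing \<open>e\<close> from \<open>T\<close> separates its ends, and
  \<open>T'\<close> joins them, so some \<open>f\<close> in \<open>T'\<close> reconnects the two
  sides. The result is a forest with the right number of edges, hence a spanning tree.\<close>

lemma is_matroid_graphical: "is_matroid (graphical_matroid G)"
  unfolding is_matroid_def
proof (intro conjI ballI)
  show "finite (ground (graphical_matroid G))" by (simp add: finite_edges)
  obtain T where "spanning_tree G T" using forest_extends[of "{}"] by (auto simp: forest_def)
  then show "bases (graphical_matroid G) \<noteq> {}" using bases_graphical by blast
next
  fix T assume "T \<in> bases (graphical_matroid G)"
  then show "T \<subseteq> ground (graphical_matroid G)" by (simp add: spanning_tree_def)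
next
  fix T T' e assume T: "T \<in> bases (graphical_matroid G)" "T' \<in> bases (graphical_matroid G)"
    and e: "e \<in> T - T'"
  have T_edges: "T \<subseteq> edges G" "T' \<subseteq> edges G" "forest d T" "card T + 1 = card (verts G)"
    using T by (auto simp: spanning_tree_iff_card)
  obtain u v where uv: "u \<in> verts G" "v \<in> verts G" "d e = {u, v}"
    using edge_in_verts[OF T_edges(1)] e by blast
  have cut: "(u, v) \<notin> reach d (T - {e})" using T_edges(3) e uv(3) by (auto simp: forest_def)
  have "(u, v) \<in> reach d T'" using T(2) uv by (simp add: spanning_tree_iff)
  then obtain f a b where f: "f \<in> T'" "d f = {a, b}" "(a, b) \<notin> reach d (T - {e})"
    using cut by (rule crossing_edge)
  have "f \<notin> T - {e}" using f(2,3) reach_edge by metis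
  then have fT: "f \<in> T' - T" using f(1) e by blast
  have "forest d (T - {e})" using T_edges(3) by (rule forest_subset) auto
  then have "forest d (insert f (T - {e}))" by (rule forest_insert[where d = d, OF _ f(2,3)])
  moreover have "card (insert f (T - {e})) = card T"
    using e fT T_edges(1) finite_edges finite_subset by (intro card_exchange) auto
  ultimately have "spanning_tree G (insert f (T - {e}))"
    using T_edges f(1) by (auto simp: spanning_tree_iff_card)
  then show "\<exists>f\<in>T' - T. insert f (T - {e}) \<in> bases (graphical_matroid G)"
    using fT by auto
qed

end

sublocale connected_mgraph \<subseteq> M: matroid_bases "graphical_matroid G"
  by unfold_locales (rule is_matroid_graphical)

context connected_mgraph
begin

section \<open>Rank and the number of covered vertices\<close>

abbreviation "rk \<equiv> rank (graphical_matroid G)"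

lemma rank_edges: "rk (edges G) + 1 = card (verts G)"
proof -
  obtain T where T: "spanning_tree G T" using M.bases_nonempty by auto
  then show ?thesis using M.card_basis[of T] by (simp add: spanning_tree_iff_card)
qed

text \<open>The part of a spanning tree in \<open>X\<close> is a forest on \<open>W\<close>. For
  \<open>H\<close> this bounds the rank of its edge set by \<open>card (verts H) - 1\<close>, so a
  bound on \<open>x\<close> by the rank is enough.\<close>

lemma rank_less_card_verts:
  assumes "X \<subseteq> edges G" "\<And>e. e \<in> X \<Longrightarrow> d e \<subseteq> W" "finite W" "W \<noteq> {}"
  shows "rk X + 1 \<le> card W"
proof -
  obtain T where T: "T \<in> bases (graphical_matroid G)" "card (T \<inter> X) = rk X" by (rule M.rank_attained)
  have fin: "finite (T \<inter> X)" using assms(1) finite_edges finite_subset by blast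
  have "forest d T" using T(1) by (simp add: spanning_tree_iff)
  then have "forest d (T \<inter> X)" by (rule forest_subset) blast
  moreover have "\<exists>u\<in>W. \<exists>v\<in>W. d e = {u, v}" if "e \<in> T \<inter> X" for e
    using edge_in_verts[OF assms(1), of e] assms(2)[of e] that by auto
  ultimately show ?thesis using forest_card_less[OF fin _ assms(3,4)] T(2) by metis
qed

text \<open>Let \<open>T \<inter> A\<close> be a maximal forest in \<open>A\<close>. If it did not connect the vertices covered by \<open>A\<close>,
  then the edges inside one of its components would form a separator of \<open>M|A\<close>.\<close>

lemma card_verts_le_rank:
  assumes A: "A \<subseteq> edges G" "A \<noteq> {}"
    and conn: "two_connected_matroid (restriction (graphical_matroid G) A)"
  shows "card (\<Union>(d ` A)) \<le> rk A + 1"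
proof -
  define W where "W = \<Union>(d ` A)"
  have W: "finite W" "W \<noteq> {}"
  proof -
    show "finite W" using A(1) finite_verts edge_in_verts[OF A(1)] finite_edges
      unfolding W_def by (intro finite_UN_I[OF finite_subset[OF A(1) finite_edges]]) fastforce
    show "W \<noteq> {}" using A edge_in_verts[OF A(1)] unfolding W_def by fastforce
  qed
  obtain T where T: "T \<in> bases (graphical_matroid G)" "card (T \<inter> A) = rk A" by (rule M.rank_attained)
  define F where "F = T \<inter> A"
  have F: "F \<subseteq> edges G" "finite F"
    using A(1) finite_edges finite_subset by (auto simp: F_def)
  have forest_F: "forest d F"
    using T(1) forest_subset[of d T F] by (simp add: F_def spanning_tree_iff)
  \<comment> \<open>An edge of \<open>A\<close> between two components of \<open>F\<close> could be
    added to the forest, which would exceed the rank of \<open>A\<close>.\<close>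
  have spans: "(u, v) \<in> reach d F" if f: "f \<in> A" "d f = {u, v}" for f u v
  proof (rule ccontr)
    assume nuv: "(u, v) \<notin> reach d F"
    have "forest d (insert f F)" by (rule forest_insert[where d = d, OF forest_F f(2) nuv])
    then obtain B where B: "spanning_tree G B" "insert f F \<subseteq> B"
      using forest_extends F(1) f(1) A(1) by (metis insert_subset subsetD)
    have "f \<notin> F" using nuv f(2) reach_edge by metis
    then have "card F < card (insert f F)" using F(2) by simp
    also have "\<dots> \<le> card (B \<inter> A)"
      using B f(1) A(1) finite_edges finite_subset by (intro card_mono) (auto simp: F_def)
    also have "\<dots> \<le> rk A" using B(1) by (intro M.card_le_rank) simp
    finally show False using T(2) by (simp add: F_def)
  qed
  have "(w, w') \<in> reach d F" if w: "w \<in> W" "w' \<in> W" for w w'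
  proof (rule ccontr)
    assume nw: "(w, w') \<notin> reach d F"
    \<comment> \<open>\<open>U\<close> is the component of \<open>w\<close> in \<open>F\<close>. No
      edge of \<open>A\<close> leaves it, so \<open>A1\<close> and \<open>A - A1\<close> split
      \<open>A\<close>, and both are nonempty because \<open>w\<close> and \<open>w'\<close> are
      covered by \<open>A\<close>.\<close>
    define U where "U = {a. (w, a) \<in> reach d F}"
    define A1 where "A1 = {f \<in> A. d f \<subseteq> U}"
    have U_closed: "a \<in> U \<longleftrightarrow> b \<in> U" if "(a, b) \<in> reach d F" for a b
      using that reach_trans reach_sym by (fastforce simp: U_def)
    have split: "d f \<subseteq> U \<or> d f \<inter> U = {}" if f: "f \<in> A" for f
    proof -
      obtain u v where uv: "d f = {u, v}" using edge_in_verts[OF A(1) f] by blast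
      then show ?thesis using U_closed[OF spans[OF f uv]] by auto
    qed
    obtain f f' where f: "f \<in> A" "w \<in> d f" "f' \<in> A" "w' \<in> d f'" using w by (auto simp: W_def)
    have "w \<in> U" "w' \<notin> U" using nw by (auto simp: U_def)
    then have A1: "A1 \<noteq> {}" "A1 \<subset> A" using f split by (auto simp: A1_def)
    \<comment> \<open>A walk in \<open>F\<close> never changes sides, so each part of
      \<open>F\<close> alone joins the ends of the edges on its side.\<close>
    have inside: "(a, b) \<in> reach d (T \<inter> A1)" if "(a, b) \<in> reach d F" "a \<in> U" for a b
      using that(1)
    proof (induction rule: reach_induct)
      case (step b c e)
      have "b \<in> U" using step U_closed that by blast
      then have "e \<in> T \<inter> A1" using step split[of e] by (auto simp: F_def A1_def)
      then show ?case using step reach_trans reach_edge by metis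
    qed simp
    have outside: "(a, b) \<in> reach d (T \<inter> (A - A1))" if "(a, b) \<in> reach d F" "a \<notin> U" for a b
      using that(1)
    proof (induction rule: reach_induct)
      case (step b c e)
      have "b \<notin> U" using step U_closed that by blast
      then have "e \<in> T \<inter> (A - A1)" using step by (auto simp: F_def A1_def)
      then show ?case using step reach_trans reach_edge by metis
    qed simp
    \<comment> \<open>If \<open>T \<inter> X\<close> already joins the ends of every edge of
      \<open>X\<close>, adding such an edge would close a cycle, so \<open>T \<inter> X\<close> is
      maximal in \<open>X\<close>.\<close>
    have rank_part: "card (T \<inter> X) = rk X"
      if X: "X \<subseteq> A" "\<And>f u v. f \<in> X \<Longrightarrow> d f = {u, v} \<Longrightarrow> (u, v) \<in> reach d (T \<inter> X)" for X
    proof (rule M.card_eq_rank_if_maximal[OF T(1)])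
      fix B assume B: "B \<in> bases (graphical_matroid G)" "T \<inter> X \<subseteq> B"
      show "B \<inter> X \<subseteq> T"
      proof (rule ccontr)
        assume "\<not> B \<inter> X \<subseteq> T"
        then obtain g where g: "g \<in> B" "g \<in> X" "g \<notin> T" by blast
        obtain u v where uv: "d g = {u, v}" using edge_in_verts[OF A(1)] g(2) X(1) by blast
        have "(u, v) \<in> reach d (T \<inter> X)" using X(2) g(2) uv by blast
        then have "(u, v) \<in> reach d (B - {g})" by (rule reach_mono[rotated]) (use B(2) g(3) in blast)
        moreover have "forest d B" using B(1) by (simp add: spanning_tree_iff)
        ultimately show False using g(1) uv by (auto simp: forest_def)
      qed
    qed
    have "card (T \<inter> A1) = rk A1"
    proof (rule rank_part)
      fix f u v assume "f \<in> A1" "d f = {u, v}"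
      then show "(u, v) \<in> reach d (T \<inter> A1)" using spans inside by (auto simp: A1_def)
    qed (use A1 in blast)
    moreover have "card (T \<inter> (A - A1)) = rk (A - A1)"
    proof (rule rank_part)
      fix f u v assume f: "f \<in> A - A1" "d f = {u, v}"
      then have "u \<notin> U" using split[of f] by (auto simp: A1_def)
      then show "(u, v) \<in> reach d (T \<inter> (A - A1))" using spans[of f] outside f by blast
    qed blast
    moreover have "card (T \<inter> A) = card (T \<inter> A1) + card (T \<inter> (A - A1))"
    proof -
      have "T \<inter> A = T \<inter> A1 \<union> T \<inter> (A - A1)" using A1 by blast
      moreover have "card (T \<inter> A1 \<union> T \<inter> (A - A1)) = card (T \<inter> A1) + card (T \<inter> (A - A1))"
        using M.finite_basis[OF T(1)] by (intro card_Un_disjoint) auto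
      ultimately show ?thesis by simp
    qed
    ultimately have "rk A = rk A1 + rk (A - A1)" using T(2) by simp
    then show False using conn A1 unfolding M.two_connected_restriction_iff by blast
  qed
  moreover have "\<exists>u\<in>W. \<exists>v\<in>W. d e = {u, v}" if "e \<in> F" for e
  proof -
    have "e \<in> A" using that by (simp add: F_def)
    then obtain u v where "d e = {u, v}" using edge_in_verts[OF A(1)] by blast
    moreover from this have "u \<in> W" "v \<in> W" using \<open>e \<in> A\<close> by (auto simp: W_def)
    ultimately show ?thesis by blast
  qed
  ultimately have "card F + 1 = card W"
    using forest_card_eq_iff[OF F(2) forest_F W] by metis
  then show ?thesis using T(2) by (simp add: F_def W_def)
qed

end

section \<open>From the basis polytope to induced subgraphs\<close>

theorem corollary2p5:
  fixes G H :: "('v, 'e) mgraph" and x :: "'e \<Rightarrow> real"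
  assumes "graph G" and "two_connected_graph G"
    and "induced_subgraph H G" and "two_connected_graph H"
    and "\<not> locked_subgraph H G"
    and "\<And>P. essential_parallel_closure (graphical_matroid G) P \<Longrightarrow> (\<Sum>e\<in>P. x e) \<le> 1"
    and "\<And>S. essential_coparallel_closure (graphical_matroid G) S \<Longrightarrow>
           (\<Sum>e\<in>S. x e) \<ge> real (card S) - 1"
    and "\<And>K. locked_subgraph K G \<Longrightarrow> (\<Sum>e\<in>edges K. x e) \<le> real (card (verts K)) - 1"
    and "(\<Sum>e\<in>edges G. x e) = real (card (verts G)) - 1"
  shows "(\<Sum>e\<in>edges H. x e) \<le> real (card (verts H)) - 1"
proof -
  interpret connected_mgraph G
    using assms(1,2) by unfold_locales (simp_all add: two_connected_graph_def)
  have H: "graph H" "verts H \<subseteq> verts G" "edges H = {e \<in> edges G. ends G e \<subseteq> verts H}"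
    using assms(3) by (auto simp: induced_subgraph_def subgraph_def)
  have finH: "finite (verts H)" and neH: "verts H \<noteq> {}"
    using H(1) assms(4) by (auto simp: graph_def two_connected_graph_def connected_graph_def)
  have rank_H: "rk (edges H) + 1 \<le> card (verts H)"
    using H(3) finH neH by (intro rank_less_card_verts) auto
  have locked: "sum x L \<le> real (rk L)" if L: "locked_subset (graphical_matroid G) L" for L
  proof -
    \<comment> \<open>Taking only the vertices covered by \<open>L\<close> gives the strongest
      constraint among the subgraphs with edge set \<open>L\<close>; it is at least as strong as the
      rank constraint.\<close>
    define K where "K = \<lparr>verts = \<Union>(ends G ` L), edges = L, ends = ends G\<rparr>"
    have L': "L \<subseteq> edges G" "L \<noteq> {}"
      "two_connected_matroid (restriction (graphical_matroid G) L)"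
      using L by (auto simp: locked_subset_def)
    have "finite L" using L'(1) finite_edges finite_subset by blast
    moreover have "ends G e \<subseteq> verts G \<and> card (ends G e) \<in> {1, 2}" if "e \<in> L" for e
      using graph L'(1) that by (auto simp: graph_def)
    moreover from this have "\<Union>(ends G ` L) \<subseteq> verts G" by blast
    moreover from this have "finite (\<Union>(ends G ` L))" using finite_verts by (rule finite_subset)
    ultimately have "subgraph K G"
      using L'(1) by (auto simp: K_def subgraph_def graph_def)
    then have "locked_subgraph K G"
      using L by (simp add: K_def locked_subgraph_def)
    then have "sum x L \<le> real (card (\<Union>(ends G ` L))) - 1"
      using assms(8)[of K] by (simp add: K_def)
    then show ?thesis using card_verts_le_rank[OF L'(1,2,3)] by linarith
  qed
  have "two_connected_matroid (graphical_matroid G)"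
    using assms(2) by (simp add: two_connected_graph_def)
  moreover have total: "sum x (edges G) = real (rk (edges G))" using assms(9) rank_edges by simp
  ultimately have "(\<forall>A\<subseteq>edges G. sum x A \<le> real (rk A)) \<or> card (edges G) = 2 \<and> rk (edges G) = 1"
    using M.basis_polytope_constraints[of x] assms(6,7) locked by simp
  then consider "\<forall>A\<subseteq>edges G. sum x A \<le> real (rk A)" | "card (edges G) = 2" "rk (edges G) = 1"
    by blast
  then show ?thesis
  proof cases
    case 1
    then have "sum x (edges H) \<le> real (rk (edges H))" using H(3) by blast
    then show ?thesis using rank_H by simp
  next
    case 2
    \<comment> \<open>Here \<open>G\<close> has two vertices. If \<open>H\<close> has both, being
      induced it has all edges; otherwise its edges have rank 0, and connectedness of the matroid
      forbids a nonempty proper subset of rank 0.\<close>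
    have "edges H = {} \<or> edges H = edges G"
    proof (rule ccontr)
      assume *: "\<not> (edges H = {} \<or> edges H = edges G)"
      have "card (verts H) \<noteq> card (verts G)"
      proof
        assume "card (verts H) = card (verts G)"
        then have "verts H = verts G" using H(2) finite_verts by (simp add: card_subset_eq)
        then show False using * H(3) graph by (auto simp: graph_def)
      qed
      then have "card (verts H) < 2"
        using card_mono[OF finite_verts H(2)] rank_edges 2(2) by simp
      then have "rk (edges H) = 0" using rank_H by simp
      moreover have "edges H \<subset> edges G" using * H(3) by blast
      ultimately have "rk (edges G) < rk (edges G - edges H)"
        using M.two_connected_rank_less[of "edges H"] * \<open>two_connected_matroid (graphical_matroid G)\<close>
        by simp
      then show False using M.rank_mono[of "edges G - edges H" "edges G"] by simp
    qed
    then show ?thesis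
    proof
      assume "edges H = {}"
      then show ?thesis using rank_H by simp
    next
      assume "edges H = edges G"
      then show ?thesis using rank_H total by simp
    qed
  qed
qed

end
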